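(* Let $n\ge0$ be an integer, $\varrho>-1$, $\Upsilon$ a positive integer. For $X\neq0$ and $Y>0$, the 2D Hermite–Konhauser polynomials satisfy $${}_{\Upsilon}H_n^{\varrho}(X,Y)=Y^{-\varrho}\left(\,[2X(1-D_Y^{-\Upsilon})]^n\sum_{s=0}^{[n/2]}\frac{(\frac{-n}{2})_s(\frac{-n+1}{2})_s}{s!}\left[\frac{-1}{X^2(1-D_Y^{-\Upsilon})}\right]^s\right)\left[\frac{Y^{\varrho}}{\Gamma(\varrho+1)}\right].$$
   Context: $(a)_k$ is the Pochhammer symbol and $[\cdot]$ the integer part. The 2D Hermite–Konhauser polynomials are $${}_{\Upsilon}H_n^{\varrho}(X,Y)=\sum_{s=0}^{[n/2]}\sum_{r=0}^{n-s}\frac{(-1)^s(-n)_{2s}(-n)_{s+r}}{(-n)_s\,\Gamma(\varrho+1+\Upsilon r)\,s!\,r!}(2X)^{n-2s}Y^{\Upsilon r}.$$ $D_Y^{-1}f(Y)=\int_0^Yf(t)\,dt$, and $D_Y^{-\Upsilon}$ is its $\Upsilon$-fold iterate. In each term the powers of $(1-D_Y^{-\Upsilon})$ are combined, giving $(1-D_Y^{-\Upsilon})^{n-s}$ with $n-s\ge0$, which acts on the function $Y^\varrho/\Gamma(\varrho+1)$; the result is then multiplied by $Y^{-\varrho}$. *)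

theory Defs
  imports "HOL-Analysis.Analysis"
begin

definition hermite_konhauser :: "nat \<Rightarrow> real \<Rightarrow> nat \<Rightarrow> real \<Rightarrow> real \<Rightarrow> real" where
  "hermite_konhauser \<Upsilon> \<rho> n X Y =
     (\<Sum>s = 0..n div 2. \<Sum>r = 0..n - s.
        ((-1) ^ s * pochhammer (- real n) (2 * s) * pochhammer (- real n) (s + r)) /
        (pochhammer (- real n) s * Gamma (\<rho> + 1 + real (\<Upsilon> * r)) * fact s * fact r)
        * (2 * X) ^ (n - 2 * s) * Y ^ (\<Upsilon> * r))"

text \<open>
  The integral from \<open>0\<close> to \<open>Y\<close>, for \<open>Y \<ge> 0\<close>. The gauge integral also covers an integrable
  singularity at \<open>0\<close>, as for \<open>t powr \<rho>\<close> with \<open>-1 < \<rho> < 0\<close>. For \<open>Y < 0\<close> the value is \<open>0\<close>,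
  which does not affect values at positive arguments.
\<close>

definition D_inv :: "(real \<Rightarrow> real) \<Rightarrow> real \<Rightarrow> real" where
  "D_inv f = (\<lambda>Y. integral {0..Y} f)"

definition one_minus_D_inv :: "nat \<Rightarrow> (real \<Rightarrow> real) \<Rightarrow> real \<Rightarrow> real" where
  "one_minus_D_inv \<Upsilon> f = (\<lambda>Y. f Y - (D_inv ^^ \<Upsilon>) f Y)"

text \<open>
  With \<open>A = 1 - D_Y\<^sup>-\<^sup>\<Upsilon>\<close> this is the operator \<open>[2 X A]\<^sup>n [-1 / (X\<^sup>2 A)]\<^sup>s\<close>. The powers of \<open>A\<close> are
  combined into \<open>A\<^sup>n\<^sup>-\<^sup>s\<close>, so no inverse of \<open>A\<close> is needed; meaningful for \<open>s \<le> n\<close>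
  (natural-number subtraction) and \<open>X \<noteq> 0\<close>.
\<close>

definition combined_power :: "nat \<Rightarrow> real \<Rightarrow> nat \<Rightarrow> nat \<Rightarrow> (real \<Rightarrow> real) \<Rightarrow> real \<Rightarrow> real" where
  "combined_power \<Upsilon> X n s f =
     (\<lambda>Y. (2 * X) ^ n * (- 1 / X ^ 2) ^ s * (one_minus_D_inv \<Upsilon> ^^ (n - s)) f Y)"

definition hermite_operator :: "nat \<Rightarrow> nat \<Rightarrow> real \<Rightarrow> (real \<Rightarrow> real) \<Rightarrow> real \<Rightarrow> real" where
  "hermite_operator \<Upsilon> n X f =
     (\<lambda>Y. \<Sum>s = 0..n div 2.
        pochhammer (- real n / 2) s * pochhammer ((- real n + 1) / 2) s / fact s
        * combined_power \<Upsilon> X n s f Y)"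

end

(* Integration from 0 raises the exponent of t powr a / Gamma (a + 1) by one, so the binomial
   theorem expands (1 - D^-U)^(n - s) applied to Y powr rho / Gamma (rho + 1). With
   (-n)_(2 s) = 4^s (-n/2)_s ((-n + 1)/2)_s and (-n)_(s + r) / (-n)_s = (-(n - s))_r the
   coefficients then agree term by term. *)
theory Submission imports Defs
begin

text \<open>The factor \<open>1 / (a + 1)\<close> produced by integration is absorbed by
  \<open>Gamma (a + 2) = (a + 1) * Gamma (a + 1)\<close>, so with this normalisation no constants
  accumulate under iteration.\<close>

lemma has_integral_powr_over_Gamma:
  fixes a y :: real
  assumes "a > -1" and "y \<ge> 0"
  shows "((\<lambda>t. t powr a / Gamma (a + 1)) has_integral y powr (a + 1) / Gamma (a + 2)) {0..y}"
proof -
  have "Gamma (a + 2) = (a + 1) * Gamma (a + 1)"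
    using assms(1) Gamma_plus1[of "a + 1"] nonpos_Ints_nonpos[of "a + 1"]
    by (force simp: add.assoc)
  then show ?thesis
    using has_integral_divide[OF has_integral_powr_from_0[OF assms], of "Gamma (a + 1)"]
    by (simp add: ac_simps)
qed

text \<open>Finite sums are treated because each further factor \<open>1 - D^-\<Upsilon>\<close>
  meets an already expanded sum. The formula for \<open>f\<close> is required only at
  \<open>t \<ge> 0\<close>, where the expansion is available; integrals from 0 to \<open>y\<close>
  see nothing else.\<close>

lemma D_inv_funpow_sum:
  assumes "finite A" and "\<And>i. i \<in> A \<Longrightarrow> a i > -1" and "y \<ge> 0"
    and "\<And>t. t \<ge> 0 \<Longrightarrow> f t = (\<Sum>i\<in>A. c i * (t powr a i / Gamma (a i + 1)))"
  shows "(D_inv ^^ k) f y = (\<Sum>i\<in>A. c i * (y powr (a i + real k) / Gamma (a i + real k + 1)))"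
  using assms(3)
proof (induction k arbitrary: y)
  case 0
  then show ?case by (simp add: assms(4))
next
  case (Suc k)
  have step: "(D_inv ^^ Suc k) f y = integral {0..y} ((D_inv ^^ k) f)"
    by (simp add: D_inv_def[of "(D_inv ^^ k) f"])
  have "((\<lambda>t. \<Sum>i\<in>A. c i * (t powr (a i + real k) / Gamma (a i + real k + 1))) has_integral
      (\<Sum>i\<in>A. c i * (y powr (a i + real k + 1) / Gamma (a i + real k + 2)))) {0..y}"
  proof (intro has_integral_sum \<open>finite A\<close> has_integral_mult_right has_integral_powr_over_Gamma
      Suc.prems)
    fix i assume "i \<in> A"
    then show "a i + real k > -1" using assms(2)[of i] by simp
  qed
  then have "((D_inv ^^ k) f has_integral
      (\<Sum>i\<in>A. c i * (y powr (a i + real k + 1) / Gamma (a i + real k + 2)))) {0..y}"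
    by (rule has_integral_eq[rotated]) (simp add: Suc.IH)
  then show ?case
    unfolding step by (simp add: integral_unique ac_simps)
qed

lemma one_minus_D_inv_funpow_powr:
  assumes "\<rho> > -1" and "y \<ge> 0"
  shows "(one_minus_D_inv \<Upsilon> ^^ m) (\<lambda>t. t powr \<rho> / Gamma (\<rho> + 1)) y =
    (\<Sum>r\<le>m. (-1) ^ r * real (m choose r) *
      (y powr (\<rho> + real (\<Upsilon> * r)) / Gamma (\<rho> + real (\<Upsilon> * r) + 1)))"
  using assms(2)
proof (induction m arbitrary: y)
  case 0
  then show ?case by simp
next
  case (Suc m)
  \<comment> \<open>Applying \<open>D_inv\<close> \<Upsilon> times turns \<open>g r\<close> into
    \<open>g (Suc r)\<close>, so the induction step becomes an index shift.\<close>
  define g where "g r = y powr (\<rho> + real (\<Upsilon> * r)) / Gamma (\<rho> + real (\<Upsilon> * r) + 1)" for r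
  let ?f = "(one_minus_D_inv \<Upsilon> ^^ m) (\<lambda>t. t powr \<rho> / Gamma (\<rho> + 1))"
  have "\<rho> + real (\<Upsilon> * r) > -1" for r
    using assms(1) by (simp add: add_increasing2 less_le_trans)
  then have "(D_inv ^^ \<Upsilon>) ?f y = (\<Sum>r\<le>m. (-1) ^ r * real (m choose r) * g (Suc r))"
    by (subst D_inv_funpow_sum[OF finite_atMost _ Suc.prems Suc.IH]) (simp_all add: g_def algebra_simps)
  then have "(one_minus_D_inv \<Upsilon> ^^ Suc m) (\<lambda>t. t powr \<rho> / Gamma (\<rho> + 1)) y =
      (\<Sum>r\<le>m. (-1) ^ r * real (m choose r) * g r) -
      (\<Sum>r\<le>m. (-1) ^ r * real (m choose r) * g (Suc r))"
    using Suc by (simp add: one_minus_D_inv_def[of _ ?f] g_def)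
  \<comment> \<open>The added term vanishes since \<open>m choose Suc m = 0\<close>. Splitting off
    \<open>r = 0\<close> next aligns both sums, and Pascal's rule merges them.\<close>
  also have "(\<Sum>r\<le>m. (-1) ^ r * real (m choose r) * g r) =
      (\<Sum>r\<le>Suc m. (-1) ^ r * real (m choose r) * g r)"
    by simp
  also have "\<dots> - (\<Sum>r\<le>m. (-1) ^ r * real (m choose r) * g (Suc r)) =
      (\<Sum>r\<le>Suc m. (-1) ^ r * real (Suc m choose r) * g r)"
    unfolding sum.atMost_Suc_shift
    by (simp add: algebra_simps sum.distrib sum_negf sum_subtractf)
  finally show ?case by (simp add: g_def)
qed

lemma pochhammer_neg_nat_quotient:
  assumes "s \<le> n"
  shows "pochhammer (- real n) (s + r) / (pochhammer (- real n) s * fact r) =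
    (-1) ^ r * real ((n - s) choose r)"
proof -
  \<comment> \<open>The factors run from \<open>-n\<close> to \<open>-n + s - 1\<close>, all
    negative as \<open>s \<le> n\<close>, so the quotient can be cancelled.\<close>
  have "pochhammer (- real n) s \<noteq> 0"
    using assms by (simp add: pochhammer_of_nat_eq_0_iff)
  moreover have "pochhammer (- real n) (s + r) =
      pochhammer (- real n) s * pochhammer (- real (n - s)) r"
    using assms by (simp add: pochhammer_product' of_nat_diff)
  ultimately show ?thesis
    by (simp add: binomial_gbinomial gbinomial_pochhammer flip: power_mult_distrib)
qed

text \<open>The duplication formula at \<open>-n/2\<close> yields a factor \<open>4 ^ s\<close>,
  which is the one released by splitting \<open>(2 * X) ^ (2 * s)\<close> off
  \<open>(2 * X) ^ n\<close>; the powers of \<open>X ^ 2\<close> cancel and leave the sign.\<close>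

lemma hermite_coefficient:
  fixes X :: real
  assumes "2 * s \<le> n" and "X \<noteq> 0"
  shows "pochhammer (- real n / 2) s * pochhammer ((- real n + 1) / 2) s *
      ((2 * X) ^ n * (- 1 / X ^ 2) ^ s) =
    (-1) ^ s * pochhammer (- real n) (2 * s) * (2 * X) ^ (n - 2 * s)"
proof -
  have "pochhammer (- real n) (2 * s) =
      4 ^ s * (pochhammer (- real n / 2) s * pochhammer ((- real n + 1) / 2) s)"
    using pochhammer_double[of "- real n / 2" s]
    by (simp add: power_mult diff_divide_distrib)
  moreover have "(2 * X) ^ n = (2 * X) ^ (n - 2 * s) * (4 ^ s * (X ^ 2) ^ s)"
    using assms(1) power_add[of "2 * X" "n - 2 * s" "2 * s"]
    by (simp add: power_mult power_mult_distrib)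
  moreover have "(X ^ 2) ^ s * (- 1 / X ^ 2) ^ s = (-1) ^ s"
    using assms(2) by (simp flip: power_mult_distrib)
  ultimately show ?thesis
    by (simp add: mult_ac)
qed

theorem theorem6:
  fixes n \<Upsilon> :: nat and \<rho> X Y :: real
  assumes "\<rho> > -1" and "\<Upsilon> > 0" and "X \<noteq> 0" and "Y > 0"
  shows "hermite_konhauser \<Upsilon> \<rho> n X Y =
           Y powr (- \<rho>) * hermite_operator \<Upsilon> n X (\<lambda>t. t powr \<rho> / Gamma (\<rho> + 1)) Y"
proof -
  let ?f = "\<lambda>t. t powr \<rho> / Gamma (\<rho> + 1)"
  have *: "(\<Sum>r = 0..n - s.
        ((-1) ^ s * pochhammer (- real n) (2 * s) * pochhammer (- real n) (s + r)) /
        (pochhammer (- real n) s * Gamma (\<rho> + 1 + real (\<Upsilon> * r)) * fact s * fact r)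
        * (2 * X) ^ (n - 2 * s) * Y ^ (\<Upsilon> * r)) =
      Y powr (- \<rho>) * (pochhammer (- real n / 2) s * pochhammer ((- real n + 1) / 2) s / fact s
        * combined_power \<Upsilon> X n s ?f Y)" (is "?lhs = ?rhs") if "s \<le> n div 2" for s
  proof -
    \<comment> \<open>\<open>K\<close> collects the factors that depend on \<open>s\<close> but not
      on \<open>r\<close>, up to \<open>fact s\<close>.\<close>
    define K where "K = (-1) ^ s * pochhammer (- real n) (2 * s) * (2 * X) ^ (n - 2 * s)"
    have s: "s \<le> n" "2 * s \<le> n" using that by auto
    \<comment> \<open>Positivity of \<open>Y\<close> lets the real powers cancel and leaves a
      natural power, as in the polynomial.\<close>
    have powr: "Y powr (- \<rho>) * (c * (Y powr (\<rho> + real k) / G)) = c * (Y ^ k / G)" for c k G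
      using \<open>Y > 0\<close> by (simp add: powr_add powr_minus powr_realpow)
    have "?rhs = K / fact s * (Y powr (- \<rho>) * (one_minus_D_inv \<Upsilon> ^^ (n - s)) ?f Y)"
      unfolding combined_power_def K_def hermite_coefficient[OF s(2) \<open>X \<noteq> 0\<close>, symmetric]
      by simp
    also have "Y powr (- \<rho>) * (one_minus_D_inv \<Upsilon> ^^ (n - s)) ?f Y =
        (\<Sum>r\<le>n - s. (-1) ^ r * real ((n - s) choose r) *
          (Y ^ (\<Upsilon> * r) / Gamma (\<rho> + real (\<Upsilon> * r) + 1)))"
      using assms by (simp only: one_minus_D_inv_funpow_powr less_imp_le sum_distrib_left powr)
    also have "K / fact s * \<dots> = ?lhs"
      unfolding sum_distrib_left pochhammer_neg_nat_quotient[OF s(1), symmetric] K_def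
      by (simp add: atMost_atLeast0 ac_simps)
    finally show ?thesis by simp
  qed
  show ?thesis
    unfolding hermite_konhauser_def hermite_operator_def sum_distrib_left
    by (intro sum.cong refl *) simp
qed

end
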